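(* Let $K$ be a field, $K[X]=K[x_1,\ldots,x_n]$, let $G$ be a subgroup of the symmetric group $\mathfrak{S}_n$, and let $I$ be a proper $G$-invariant ideal of $K[X]$. Then $G$ acts on the quotient set of primary components $\mathcal{Q}[I]=\{\mathcal{Q}_P[I]\mid P\in \mathrm{Ass}(I)\}$ by $(\sigma,\mathcal{Q}_P[I])\mapsto \sigma(\mathcal{Q}_P[I])$ for $\sigma\in G$ and $\mathcal{Q}_P[I]\in\mathcal{Q}[I]$.
   Context: The group $\mathfrak{S}_n$ acts on $K[X]$ by $\sigma(f(x_1,\ldots,x_n))=f(x_{\sigma(1)},\ldots,x_{\sigma(n)})$; for an ideal $I$, $\sigma(I)=\{\sigma(f)\mid f\in I\}$. An ideal $I$ is $G$-invariant if $\sigma(I)=I$ for all $\sigma\in G$. A primary decomposition of a proper ideal $I$ is a finite set $\{Q_1,\ldots,Q_k\}$ of primary ideals with $I=Q_1\cap\cdots\cap Q_k$; it is minimal if $\sqrt{Q_i}\neq\sqrt{Q_j}$ for $i\ne j$ and $Q_i\not\supset\bigcap_{j\neq i}Q_j$ for every $i$. $\mathrm{Ass}(I)=\{\sqrt{Q_1},\ldots,\sqrt{Q_k}\}$ for a minimal primary decomposition (independent of the choice); its elements are the prime divisors of $I$. For $P\in\mathrm{Ass}(I)$, a $P$-primary component of $I$ is an ideal $Q$ with $\sqrt{Q}=P$ that occurs in some minimal primary decomposition of $I$. $\mathcal{Q}_P[I]$ denotes the set of all $P$-primary components of $I$. For a set $\mathcal{C}$ of ideals, $\sigma(\mathcal{C})=\{\sigma(Q)\mid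 Q\in\mathcal{C}\}$. *)

theory Defs
  imports
    "HOL-Algebra.Sym_Groups"
    "HOL-Algebra.Group_Action"
    "HOL-Algebra.Ideal"
    "HOL-Library.Poly_Mapping"
begin

section \<open>The polynomial ring in \<open>n\<close> variables\<close>

text \<open>
  A monomial is a finitely supported exponent vector indexed by \<^typ>\<open>nat\<close>; the ring in
  \<open>n\<close> variables consists of the polynomials involving only the variables with index
  in \<open>{1..n}\<close>, the set on which \<^const>\<open>sym_group\<close> acts.
\<close>

type_synonym 'k mpoly = "(nat \<Rightarrow>\<^sub>0 nat) \<Rightarrow>\<^sub>0 'k"

definition mpoly_const :: "'k::field \<Rightarrow> 'k mpoly" where
  "mpoly_const c = Poly_Mapping.single 0 c"

definition mpoly_var :: "nat \<Rightarrow> 'k::field mpoly" where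
  "mpoly_var i = Poly_Mapping.single (Poly_Mapping.single i 1) 1"

definition mpoly_ring :: "nat \<Rightarrow> 'k::field mpoly ring" where
  "mpoly_ring n =
    \<lparr>carrier = {f. \<forall>m \<in> Poly_Mapping.keys f. Poly_Mapping.keys m \<subseteq> {1..n}},
     mult = (*), one = 1, zero = 0, add = (+)\<rparr>"

lemma cring_mpoly_ring: "cring (mpoly_ring n :: 'k::field mpoly ring)"
proof -
  let ?R = "mpoly_ring n :: 'k mpoly ring"
  have add: "f + g \<in> carrier ?R" if "f \<in> carrier ?R" "g \<in> carrier ?R" for f g
    using that Poly_Mapping.keys_add[of f g] by (auto simp: mpoly_ring_def)
  have mult: "f * g \<in> carrier ?R" if f: "f \<in> carrier ?R" and g: "g \<in> carrier ?R" for f g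
  proof -
    have "Poly_Mapping.keys m \<subseteq> {1..n}" if m: "m \<in> Poly_Mapping.keys (f * g)" for m
    proof -
      obtain a b where ab: "m = a + b" "a \<in> Poly_Mapping.keys f" "b \<in> Poly_Mapping.keys g"
        using m Poly_Mapping.keys_mult[of f g] by blast
      then have "Poly_Mapping.keys a \<subseteq> {1..n}" "Poly_Mapping.keys b \<subseteq> {1..n}"
        using f g by (auto simp: mpoly_ring_def)
      then show ?thesis
        using ab(1) Poly_Mapping.keys_add[of a b] by blast
    qed
    then show ?thesis by (simp add: mpoly_ring_def)
  qed
  have uminus: "- f \<in> carrier ?R" if "f \<in> carrier ?R" for f
    using that by (simp add: mpoly_ring_def)
  have ops: "f \<otimes>\<^bsub>?R\<^esub> g = f * g" "f \<oplus>\<^bsub>?R\<^esub> g = f + g" "\<one>\<^bsub>?R\<^esub> = 1" "\<zero>\<^bsub>?R\<^esub> = 0" for f g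
    by (simp_all add: mpoly_ring_def)
  have zero: "0 \<in> carrier ?R" and one: "1 \<in> carrier ?R"
    by (simp_all add: mpoly_ring_def)
  have inverse: "\<exists>g\<in>carrier ?R. g + f = 0" if "f \<in> carrier ?R" for f
    using uminus[OF that] by (intro bexI[of _ "- f"]) simp_all
  have "abelian_group ?R"
    by (rule abelian_groupI, unfold ops)
      (fact add | fact zero | rule add.assoc | rule add.commute | rule add_0_left
        | erule inverse)+
  moreover have "comm_monoid ?R"
    by (rule comm_monoidI, unfold ops)
      (fact mult | fact one | rule mult.assoc | rule mult.commute | rule mult_1_left)+
  ultimately show ?thesis
    by (rule cringI, unfold ops) (rule distrib_right)
qed


section \<open>The action of permutations on polynomials and ideals\<close>

text \<open>The substitution of the variable \<open>\<sigma> i\<close> for the variable \<open>i\<close>, for every \<open>i\<close>.\<close>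

definition perm_poly :: "(nat \<Rightarrow> nat) \<Rightarrow> 'k::field mpoly \<Rightarrow> 'k mpoly" where
  "perm_poly \<sigma> f =
    (\<Sum>m \<in> Poly_Mapping.keys f. mpoly_const (Poly_Mapping.lookup f m) *
       (\<Prod>i \<in> Poly_Mapping.keys m. mpoly_var (\<sigma> i) ^ Poly_Mapping.lookup m i))"

definition perm_ideal :: "(nat \<Rightarrow> nat) \<Rightarrow> 'k::field mpoly set \<Rightarrow> 'k mpoly set" where
  "perm_ideal \<sigma> I = perm_poly \<sigma> ` I"

definition perm_ideals ::
    "(nat \<Rightarrow> nat) \<Rightarrow> 'k::field mpoly set set \<Rightarrow> 'k mpoly set set" where
  "perm_ideals \<sigma> \<C> = perm_ideal \<sigma> ` \<C>"

definition invariant_ideal :: "(nat \<Rightarrow> nat) set \<Rightarrow> 'k::field mpoly set \<Rightarrow> bool" where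
  "invariant_ideal G I \<longleftrightarrow> (\<forall>\<sigma>\<in>G. perm_ideal \<sigma> I = I)"


section \<open>Primary decomposition\<close>

definition ideal_radical :: "('a, 'b) ring_scheme \<Rightarrow> 'a set \<Rightarrow> 'a set" where
  "ideal_radical R I = {a \<in> carrier R. \<exists>k::nat. k > 0 \<and> a [^]\<^bsub>R\<^esub> k \<in> I}"

locale primaryideal = ideal + cring +
  assumes I_notcarr: "carrier R \<noteq> I"
    and I_primary: "\<lbrakk>a \<in> carrier R; b \<in> carrier R; a \<otimes> b \<in> I\<rbrakk>
      \<Longrightarrow> a \<in> I \<or> b \<in> ideal_radical R I"

text \<open>
  Intersecting with the carrier makes the intersection of the empty family equal to the
  whole ring.
\<close>

definition ideal_Inter :: "('a, 'b) ring_scheme \<Rightarrow> 'a set set \<Rightarrow> 'a set" where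
  "ideal_Inter R \<D> = carrier R \<inter> \<Inter>\<D>"

definition primary_decomposition ::
    "('a, 'b) ring_scheme \<Rightarrow> 'a set \<Rightarrow> 'a set set \<Rightarrow> bool" where
  "primary_decomposition R I \<D> \<longleftrightarrow>
    finite \<D> \<and> (\<forall>Q\<in>\<D>. primaryideal Q R) \<and> I = ideal_Inter R \<D>"

definition minimal_primary_decomposition ::
    "('a, 'b) ring_scheme \<Rightarrow> 'a set \<Rightarrow> 'a set set \<Rightarrow> bool" where
  "minimal_primary_decomposition R I \<D> \<longleftrightarrow>
    primary_decomposition R I \<D> \<and>
    (\<forall>Q\<in>\<D>. \<forall>Q'\<in>\<D>. Q \<noteq> Q' \<longrightarrow> ideal_radical R Q \<noteq> ideal_radical R Q') \<and>
    (\<forall>Q\<in>\<D>. \<not> ideal_Inter R (\<D> - {Q}) \<subseteq> Q)"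

text \<open>
  All minimal primary decompositions of an ideal have the same set of radicals, so collecting
  the radicals over all of them yields the same set as any single one.
\<close>

definition Ass :: "('a, 'b) ring_scheme \<Rightarrow> 'a set \<Rightarrow> 'a set set" where
  "Ass R I = {P. \<exists>\<D>. minimal_primary_decomposition R I \<D> \<and> P \<in> ideal_radical R ` \<D>}"

definition primary_components ::
    "('a, 'b) ring_scheme \<Rightarrow> 'a set \<Rightarrow> 'a set \<Rightarrow> 'a set set" where
  "primary_components R I P =
    {Q. ideal_radical R Q = P \<and> (\<exists>\<D>. minimal_primary_decomposition R I \<D> \<and> Q \<in> \<D>)}"

definition quotient_components ::
    "('a, 'b) ring_scheme \<Rightarrow> 'a set \<Rightarrow> 'a set set set" where
  "quotient_components R I = {primary_components R I P | P. P \<in> Ass R I}"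

end

theory Submission
  imports Defs "HOL-Algebra.QuotRing"
begin

text \<open>
  Renaming variables along \<open>\<sigma>\<close> is a ring automorphism of \<open>K[X]\<close>, functorial in \<open>\<sigma>\<close>.
  Any ring isomorphism carries minimal primary decompositions to minimal primary decompositions
  and commutes with radicals, so \<open>\<sigma>\<close> maps the set of \<open>P\<close>-primary components of \<open>I\<close> onto the set of
  \<open>\<sigma>(P)\<close>-primary components of \<open>\<sigma>(I) = I\<close>; in particular \<open>\<sigma>\<close> permutes these sets.
\<close>

section \<open>Renaming variables\<close>

text \<open>Pushforward of exponent vectors: exponents of variables with the same image add up.
  Hence additivity and functoriality hold for an arbitrary map \<sigma>, injective or not.\<close>

definition perm_monom :: "(nat \<Rightarrow> nat) \<Rightarrow> (nat \<Rightarrow>\<^sub>0 nat) \<Rightarrow> (nat \<Rightarrow>\<^sub>0 nat)" where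
  "perm_monom \<sigma> m =
    (\<Sum>i \<in> Poly_Mapping.keys m. Poly_Mapping.single (\<sigma> i) (Poly_Mapping.lookup m i))"

lemma sum_single_keys:
  "(\<Sum>k \<in> Poly_Mapping.keys p. Poly_Mapping.single k (Poly_Mapping.lookup p k)) = p"
  by (rule poly_mapping_eqI)
    (simp add: lookup_sum lookup_single when_def in_keys_iff)

lemma perm_monom_add: "perm_monom \<sigma> (a + b) = perm_monom \<sigma> a + perm_monom \<sigma> b"
  unfolding perm_monom_def by (rule setsum_keys_plus_distrib) (simp_all add: single_add)

lemma perm_monom_zero [simp]: "perm_monom \<sigma> 0 = 0"
  by (simp add: perm_monom_def)

lemma perm_monom_single [simp]:
  "perm_monom \<sigma> (Poly_Mapping.single i k) = Poly_Mapping.single (\<sigma> i) k"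
  by (simp add: perm_monom_def)

lemma perm_monom_sum: "perm_monom \<sigma> (\<Sum>x\<in>A. f x) = (\<Sum>x\<in>A. perm_monom \<sigma> (f x))"
  by (induction A rule: infinite_finite_induct) (simp_all add: perm_monom_add)

lemma perm_monom_comp: "perm_monom (\<sigma> \<circ> \<tau>) m = perm_monom \<sigma> (perm_monom \<tau> m)"
  unfolding perm_monom_def[of \<tau>] perm_monom_sum perm_monom_single by (simp add: perm_monom_def)

lemma perm_monom_id: "perm_monom id m = m"
  by (simp add: perm_monom_def sum_single_keys)

lemma keys_perm_monom: "Poly_Mapping.keys (perm_monom \<sigma> m) \<subseteq> \<sigma> ` Poly_Mapping.keys m"
  unfolding perm_monom_def
  by (rule order_trans[OF Poly_Mapping.keys_sum]) (auto split: if_splits)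

lemma mpoly_var_power:
  "(mpoly_var i :: 'k::field mpoly) ^ k = Poly_Mapping.single (Poly_Mapping.single i k) 1"
  by (induction k) (simp_all add: mpoly_var_def mult_single flip: single_add)

lemma prod_single_one:
  fixes f :: "'b \<Rightarrow> 'c::comm_monoid_add"
  shows "(\<Prod>i\<in>A. Poly_Mapping.single (f i) (1 :: 'k::field)) = Poly_Mapping.single (\<Sum>i\<in>A. f i) 1"
  by (induction A rule: infinite_finite_induct) (simp_all add: mult_single)

text \<open>Substituting variables in a monomial only relabels its exponent vector, so substitution
  acts term by term and properties of \<open>perm_monom\<close> carry over to polynomials.\<close>

lemma perm_poly_eq_sum:
  "perm_poly \<sigma> f =
    (\<Sum>m \<in> Poly_Mapping.keys f. Poly_Mapping.single (perm_monom \<sigma> m) (Poly_Mapping.lookup f m))"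
  by (simp add: perm_poly_def mpoly_var_power prod_single_one mpoly_const_def mult_single
      perm_monom_def)

text \<open>Cancellation may remove keys from \<open>f + g\<close>. This is harmless because each
  summand is additive in the coefficient and vanishes at coefficient 0.\<close>

lemma perm_poly_add: "perm_poly \<sigma> (f + g) = perm_poly \<sigma> f + perm_poly \<sigma> g"
  unfolding perm_poly_eq_sum by (rule setsum_keys_plus_distrib) (simp_all add: single_add)

lemma perm_poly_zero [simp]: "perm_poly \<sigma> 0 = 0"
  by (simp add: perm_poly_def)

lemma perm_poly_sum: "perm_poly \<sigma> (\<Sum>x\<in>A. f x) = (\<Sum>x\<in>A. perm_poly \<sigma> (f x))"
  by (induction A rule: infinite_finite_induct) (simp_all add: perm_poly_add)

lemma perm_poly_single [simp]:
  "perm_poly \<sigma> (Poly_Mapping.single m c) = Poly_Mapping.single (perm_monom \<sigma> m) c"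
  by (simp add: perm_poly_eq_sum)

lemma perm_poly_one [simp]: "perm_poly \<sigma> 1 = 1"
  by (simp flip: single_one)

text \<open>Both factors are expanded into terms; additivity reduces the claim to single terms,
  where it is \<open>perm_monom_add\<close>.\<close>

lemma perm_poly_mult: "perm_poly \<sigma> (f * g) = perm_poly \<sigma> f * perm_poly \<sigma> g"
proof -
  have "f * g = (\<Sum>m \<in> Poly_Mapping.keys f. \<Sum>l \<in> Poly_Mapping.keys g.
      Poly_Mapping.single (m + l) (Poly_Mapping.lookup f m * Poly_Mapping.lookup g l))"
    unfolding mult_single[symmetric] sum_product[symmetric] sum_single_keys ..
  then show ?thesis
    by (simp add: perm_poly_sum perm_monom_add perm_poly_eq_sum[of _ f] perm_poly_eq_sum[of _ g]
        sum_product mult_single)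
qed

lemma perm_poly_comp: "perm_poly (\<sigma> \<circ> \<tau>) f = perm_poly \<sigma> (perm_poly \<tau> f)"
  unfolding perm_poly_eq_sum[of \<tau>] perm_poly_sum perm_poly_single
  by (simp add: perm_poly_eq_sum perm_monom_comp)

lemma perm_poly_id: "perm_poly id f = f"
  by (simp add: perm_poly_eq_sum perm_monom_id sum_single_keys)

text \<open>Here \<sigma> has to respect \<open>{1..n}\<close>: the variables of the image lie in
  the \<sigma>-image of that set, which is the set itself.\<close>

lemma perm_poly_closed:
  assumes "\<sigma> permutes {1..n}" and "f \<in> carrier (mpoly_ring n)"
  shows "perm_poly \<sigma> f \<in> carrier (mpoly_ring n)"
proof -
  have "Poly_Mapping.keys m \<subseteq> {1..n}" if "m \<in> Poly_Mapping.keys (perm_poly \<sigma> f)" for m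
  proof -
    have "m \<in> (\<Union>l\<in>Poly_Mapping.keys f. Poly_Mapping.keys
        (Poly_Mapping.single (perm_monom \<sigma> l) (Poly_Mapping.lookup f l)))"
      using that unfolding perm_poly_eq_sum by (rule Poly_Mapping.keys_sum[THEN subsetD])
    then obtain l where l: "l \<in> Poly_Mapping.keys f" "m = perm_monom \<sigma> l"
      by (auto split: if_splits)
    with assms(2) have "\<sigma> ` Poly_Mapping.keys l \<subseteq> \<sigma> ` {1..n}"
      by (auto simp: mpoly_ring_def)
    with keys_perm_monom[of \<sigma> l] show ?thesis
      unfolding l(2) permutes_image[OF assms(1)] by blast
  qed
  then show ?thesis by (simp add: mpoly_ring_def)
qed

text \<open>Bijectivity follows from functoriality: renaming along the inverse permutation is a
  two-sided inverse on the carrier.\<close>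

lemma perm_poly_ring_iso:
  assumes "\<sigma> permutes {1..n}"
  shows "perm_poly \<sigma> \<in> ring_iso (mpoly_ring n) (mpoly_ring n :: 'k::field mpoly ring)"
proof (rule ring_iso_memI)
  note inv = permutes_inv_o[OF assms]
  show "bij_betw (perm_poly \<sigma>) (carrier (mpoly_ring n))
      (carrier (mpoly_ring n :: 'k mpoly ring))"
    by (rule bij_betw_byWitness[where f' = "perm_poly (inv' \<sigma>)"])
      (auto simp: inv perm_poly_id perm_poly_closed[OF assms]
          perm_poly_closed[OF permutes_inv[OF assms]] simp flip: perm_poly_comp)
qed (simp add: perm_poly_closed[OF assms],
    simp_all add: mpoly_ring_def perm_poly_add perm_poly_mult)


section \<open>Primary decompositions under ring isomorphisms\<close>

lemma minimal_primary_decomposition_subset_carrier: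
  assumes "minimal_primary_decomposition R J \<D>" and "Q \<in> \<D>"
  shows "Q \<subseteq> carrier R"
proof -
  have "primaryideal Q R"
    using assms by (simp add: minimal_primary_decomposition_def primary_decomposition_def)
  then show ?thesis
    by (intro additive_subgroup.a_subset ideal.axioms(1) primaryideal.axioms(1))
qed

text \<open>Source and target are kept apart so that the inverse map is an instance with
  \<open>R\<close> and \<open>S\<close> exchanged.\<close>

locale cring_iso = R: cring R + S: cring S
  for R (structure) and S (structure) +
  fixes h
  assumes iso: "h \<in> ring_iso R S"
begin

sublocale ring_hom_ring R S h
  by (rule ring_hom_ringI2) (use iso in \<open>auto simp: ring_iso_def R.ring_axioms S.ring_axioms\<close>)

lemma inj_on_carrier: "inj_on h (carrier R)"
  and image_carrier: "h ` carrier R = carrier S"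
  using ring_iso_memE(5)[OF iso] by (auto simp: bij_betw_def)

text \<open>Injectivity reflects membership, but only inside the carrier, since nothing is known
  about \<open>h\<close> elsewhere. This is the source of the carrier conditions below.\<close>

lemma mem_image_iff: "x \<in> carrier R \<Longrightarrow> A \<subseteq> carrier R \<Longrightarrow> h x \<in> h ` A \<longleftrightarrow> x \<in> A"
  by (rule inj_on_image_mem_iff[OF inj_on_carrier])

text \<open>Surjectivity is essential: absorption is checked by writing an arbitrary multiplier from
  \<open>S\<close> as \<open>h y\<close>.\<close>

lemma image_ideal:
  assumes "ideal J R"
  shows "ideal (h ` J) S"
proof (rule idealI)
  interpret J: ideal J R by fact
  show "subgroup (h ` J) (add_monoid S)"
    by (rule img_is_add_subgroup) (fact J.a_subgroup)
  fix a x
  assume "a \<in> h ` J" "x \<in> carrier S"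
  then obtain b y where by_eq: "a = h b" "x = h y" "b \<in> J" "y \<in> carrier R"
    using image_carrier by blast
  then have "h (y \<otimes> b) \<in> h ` J" "h (b \<otimes> y) \<in> h ` J"
    using J.I_l_closed J.I_r_closed by blast+
  then show "x \<otimes>\<^bsub>S\<^esub> a \<in> h ` J" "a \<otimes>\<^bsub>S\<^esub> x \<in> h ` J"
    using by_eq J.Icarr by simp_all
qed (fact S.ring_axioms)

text \<open>Since \<open>h\<close> commutes with powers, \<open>mem_image_iff\<close> compares the
  two radicals at each \<open>h x\<close>, and surjectivity makes these all the elements of
  \<open>S\<close>.\<close>

lemma ideal_radical_image:
  assumes "J \<subseteq> carrier R"
  shows "ideal_radical S (h ` J) = h ` ideal_radical R J"
proof -
  have "h x \<in> ideal_radical S (h ` J) \<longleftrightarrow> x \<in> ideal_radical R J" if "x \<in> carrier R" for x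
    using that mem_image_iff[OF R.nat_pow_closed[OF that] assms]
    by (simp add: ideal_radical_def hom_nat_pow[symmetric])
  moreover have "ideal_radical S (h ` J) \<subseteq> h ` carrier R" "ideal_radical R J \<subseteq> carrier R"
    by (auto simp: ideal_radical_def image_carrier)
  ultimately show ?thesis by blast
qed

lemma image_primaryideal:
  assumes "primaryideal Q R"
  shows "primaryideal (h ` Q) S"
proof -
  interpret Q: primaryideal Q R by fact
  have Q: "Q \<subseteq> carrier R" by (rule Q.a_subset)
  show ?thesis
  proof (intro primaryideal.intro primaryideal_axioms.intro image_ideal S.cring_axioms
      Q.ideal_axioms)
    show "carrier S \<noteq> h ` Q"
      using Q.I_notcarr Q inj_on_image_eq_iff[OF inj_on_carrier, of "carrier R" Q]
      by (simp add: image_carrier)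
  next
    fix a b
    assume ab: "a \<in> carrier S" "b \<in> carrier S" "a \<otimes>\<^bsub>S\<^esub> b \<in> h ` Q"
    then obtain x y where xy: "a = h x" "b = h y" "x \<in> carrier R" "y \<in> carrier R"
      using image_carrier by blast
    with ab(3) have "x \<otimes> y \<in> Q"
      using mem_image_iff[of "x \<otimes> y" Q] Q by simp
    then show "a \<in> h ` Q \<or> b \<in> ideal_radical S (h ` Q)"
      using Q.I_primary[OF xy(3,4)] xy ideal_radical_image[OF Q] by blast
  qed
qed

text \<open>Images commute with intersections because \<open>h\<close> is injective; surjectivity
  matches the carrier factors, which settles the empty family too.\<close>

lemma ideal_Inter_image:
  assumes "\<And>Q. Q \<in> \<D> \<Longrightarrow> Q \<subseteq> carrier R"
  shows "ideal_Inter S ((`) h ` \<D>) = h ` ideal_Inter R \<D>"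
proof -
  have "h x \<in> ideal_Inter S ((`) h ` \<D>) \<longleftrightarrow> x \<in> ideal_Inter R \<D>" if "x \<in> carrier R" for x
    using that mem_image_iff[OF that] assms by (simp add: ideal_Inter_def)
  moreover have "ideal_Inter S ((`) h ` \<D>) \<subseteq> h ` carrier R" "ideal_Inter R \<D> \<subseteq> carrier R"
    by (auto simp: ideal_Inter_def image_carrier)
  ultimately show ?thesis by blast
qed

lemma minimal_primary_decomposition_image:
  assumes "minimal_primary_decomposition R J \<D>"
  shows "minimal_primary_decomposition S (h ` J) ((`) h ` \<D>)"
proof -
  have D: "finite \<D>" "\<And>Q. Q \<in> \<D> \<Longrightarrow> primaryideal Q R" "J = ideal_Inter R \<D>"
    and radical: "\<And>Q Q'. Q \<in> \<D> \<Longrightarrow> Q' \<in> \<D> \<Longrightarrow> Q \<noteq> Q' \<Longrightarrow> ideal_radical R Q \<noteq> ideal_radical R Q'"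
    and irredundant: "\<And>Q. Q \<in> \<D> \<Longrightarrow> \<not> ideal_Inter R (\<D> - {Q}) \<subseteq> Q"
    using assms by (auto simp: minimal_primary_decomposition_def primary_decomposition_def)
  have sub: "Q \<subseteq> carrier R" if "Q \<in> \<D>" for Q
    using minimal_primary_decomposition_subset_carrier[OF assms that] .
  show ?thesis
    unfolding minimal_primary_decomposition_def primary_decomposition_def
  proof (intro conjI ballI impI)
    show "finite ((`) h ` \<D>)" using D(1) by simp
    show "h ` J = ideal_Inter S ((`) h ` \<D>)"
      using sub by (simp add: D(3) ideal_Inter_image)
  next
    fix Q assume "Q \<in> (`) h ` \<D>"
    then show "primaryideal Q S" using D(2) image_primaryideal by blast
  next
    fix Q Q' assume "Q \<in> (`) h ` \<D>" "Q' \<in> (`) h ` \<D>" "Q \<noteq> Q'"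
    then obtain T T' where T: "T \<in> \<D>" "T' \<in> \<D>" "T \<noteq> T'" "Q = h ` T" "Q' = h ` T'"
      by blast
    have "ideal_radical R T \<subseteq> carrier R" "ideal_radical R T' \<subseteq> carrier R"
      by (auto simp: ideal_radical_def)
    with radical[OF T(1-3)] show "ideal_radical S Q \<noteq> ideal_radical S Q'"
      using T sub by (simp add: ideal_radical_image inj_on_image_eq_iff[OF inj_on_carrier])
  next
    fix Q assume "Q \<in> (`) h ` \<D>"
    then obtain T where T: "T \<in> \<D>" "Q = h ` T" by blast
    \<comment> \<open>Deleting one image deletes exactly one member of \<D>, because distinct
      subsets of the carrier have distinct images.\<close>
    have "(`) h ` \<D> - {h ` T} = (`) h ` (\<D> - {T})"
      using T sub by (auto simp: inj_on_image_eq_iff[OF inj_on_carrier])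
    then have "ideal_Inter S ((`) h ` \<D> - {Q}) = h ` ideal_Inter R (\<D> - {T})"
      using sub ideal_Inter_image[of "\<D> - {T}"] by (simp add: T(2))
    moreover have "ideal_Inter R (\<D> - {T}) \<subseteq> carrier R"
      by (simp add: ideal_Inter_def)
    ultimately show "\<not> ideal_Inter S ((`) h ` \<D> - {Q}) \<subseteq> Q"
      using irredundant[OF T(1)] sub[OF T(1)] mem_image_iff T(2) by blast
  qed
qed

lemma image_primary_components_subset:
  "(`) h ` primary_components R J P \<subseteq> primary_components S (h ` J) (h ` P)"
  using minimal_primary_decomposition_image minimal_primary_decomposition_subset_carrier
  by (fastforce simp: primary_components_def ideal_radical_image)

lemma image_Ass:
  assumes "P \<in> Ass R J"
  shows "h ` P \<in> Ass S (h ` J)"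
proof -
  obtain \<D> Q where D: "minimal_primary_decomposition R J \<D>" "Q \<in> \<D>" "P = ideal_radical R Q"
    using assms by (auto simp: Ass_def)
  then have "h ` P = ideal_radical S (h ` Q)"
    using minimal_primary_decomposition_subset_carrier ideal_radical_image by metis
  then show ?thesis
    using minimal_primary_decomposition_image[OF D(1)] D(2) unfolding Ass_def by blast
qed

lemma image_primary_components:
  assumes J: "J \<subseteq> carrier R" and P: "P \<subseteq> carrier R"
  shows "(`) h ` primary_components R J P = primary_components S (h ` J) (h ` P)"
proof
  let ?k = "inv_into (carrier R) h"
  \<comment> \<open>The reverse inclusion is the inclusion already shown, applied to the inverse
    isomorphism and pulled back along \<open>h\<close>.\<close>
  interpret inv: cring_iso S R ?k
    by (intro cring_iso.intro cring_iso_axioms.intro ring_iso_set_sym iso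
        R.ring_axioms R.cring_axioms S.cring_axioms)
  have kh: "?k ` h ` A = A" if "A \<subseteq> carrier R" for A
    using that inj_on_carrier by (rule inv_into_image_cancel[rotated])
  have hk: "h ` ?k ` A = A" if "A \<subseteq> carrier S" for A
    using image_carrier that by (rule image_inv_into_cancel)
  show "primary_components S (h ` J) (h ` P) \<subseteq> (`) h ` primary_components R J P"
  proof
    fix Q assume Q: "Q \<in> primary_components S (h ` J) (h ` P)"
    then have "?k ` Q \<in> primary_components R J P"
      using inv.image_primary_components_subset[of "h ` J" "h ` P"] by (auto simp: kh J P)
    \<comment> \<open>Needed for \<open>hk\<close>, which recovers \<open>Q\<close> as the image of
      its pullback.\<close>
    moreover have "Q \<subseteq> carrier S"
      using Q minimal_primary_decomposition_subset_carrier[of S]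
      unfolding primary_components_def by blast
    ultimately show "Q \<in> (`) h ` primary_components R J P"
      by (metis hk image_eqI)
  qed
qed (fact image_primary_components_subset)

end


section \<open>The action on the primary components\<close>

lemma perm_ideals_comp: "perm_ideals (\<sigma> \<circ> \<tau>) \<C> = perm_ideals \<sigma> (perm_ideals \<tau> \<C>)"
  by (simp add: perm_ideals_def perm_ideal_def perm_poly_comp image_image)

lemma perm_ideals_id: "perm_ideals id \<C> = \<C>"
  by (simp add: perm_ideals_def perm_ideal_def perm_poly_id)

text \<open>The components for \<open>P\<close> are carried onto those for the \<sigma>-image of
  \<open>P\<close>, again a prime divisor because \<open>I\<close> is fixed by \<sigma>.\<close>

lemma perm_ideals_quotient_components:
  assumes perm: "\<sigma> permutes {1..n}"
    and I: "I \<subseteq> carrier (mpoly_ring n)" "perm_ideal \<sigma> I = I"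
    and "\<C> \<in> quotient_components (mpoly_ring n) I"
  shows "perm_ideals \<sigma> \<C> \<in> quotient_components (mpoly_ring n) I"
proof -
  let ?R = "mpoly_ring n"
  interpret cring_iso ?R ?R "perm_poly \<sigma>"
    by (intro cring_iso.intro cring_iso_axioms.intro cring_mpoly_ring perm_poly_ring_iso perm)
  obtain P where P: "P \<in> Ass ?R I" "\<C> = primary_components ?R I P"
    using assms(4) by (auto simp: quotient_components_def)
  have "P \<subseteq> carrier ?R"
    using P(1) by (auto simp: Ass_def ideal_radical_def)
  then have "perm_ideals \<sigma> \<C> = primary_components ?R I (perm_poly \<sigma> ` P)"
    using image_primary_components[OF I(1)] I(2)
    by (simp add: P(2) perm_ideals_def perm_ideal_def)
  moreover have "perm_poly \<sigma> ` P \<in> Ass ?R I"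
    using image_Ass[OF P(1)] I(2) by (simp add: perm_ideal_def)
  ultimately show ?thesis by (auto simp: quotient_components_def)
qed

theorem theorem3p1p8:
  fixes n :: nat
    and G :: "(nat \<Rightarrow> nat) set"
    and I :: "'k::field mpoly set"
  assumes "subgroup G (sym_group n)"
    and "ideal I (mpoly_ring n)"
    and "I \<noteq> carrier (mpoly_ring n)"
    and "invariant_ideal G I"
  shows "group_action (sym_group n\<lparr>carrier := G\<rparr>)
           (quotient_components (mpoly_ring n) I)
           (\<lambda>\<sigma>. \<lambda>\<C> \<in> quotient_components (mpoly_ring n) I. perm_ideals \<sigma> \<C>)"
proof -
  let ?E = "quotient_components (mpoly_ring n) I"
  let ?\<phi> = "\<lambda>\<sigma>. \<lambda>\<C> \<in> ?E. perm_ideals \<sigma> \<C>"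
  have perm: "\<sigma> permutes {1..n}" if "\<sigma> \<in> G" for \<sigma>
    using subgroup.subset[OF assms(1)] that by (auto simp: sym_group_carrier)
  \<comment> \<open>Inversion in \<open>sym_group\<close> is functional inversion, so the inverse
    witnessing bijectivity below also comes from \<open>G\<close>.\<close>
  have inv_mem: "inv' \<sigma> \<in> G" if "\<sigma> \<in> G" for \<sigma>
    using subgroup.m_inv_closed[OF assms(1) that] perm[OF that] by (simp add: sym_group_carrier)
  have closed: "perm_ideals \<sigma> \<C> \<in> ?E" if "\<sigma> \<in> G" "\<C> \<in> ?E" for \<sigma> \<C>
    using perm_ideals_quotient_components[OF perm[OF that(1)]
        additive_subgroup.a_subset[OF ideal.axioms(1)[OF assms(2)]] _ that(2)] that(1) assms(4)
    by (simp add: invariant_ideal_def)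
  \<comment> \<open>\<open>Bij\<close> demands an extensional bijection; the restricted abstraction
    in \<open>?\<phi>\<close> provides extensionality.\<close>
  have Bij: "?\<phi> \<sigma> \<in> Bij ?E" if "\<sigma> \<in> G" for \<sigma>
  proof -
    have "bij_betw (perm_ideals \<sigma>) ?E ?E"
      by (rule bij_betw_byWitness[where f' = "perm_ideals (inv' \<sigma>)"])
        (auto simp: closed that inv_mem permutes_inv_o[OF perm[OF that]] perm_ideals_id
          simp flip: perm_ideals_comp)
    then show ?thesis by (simp add: Bij_def)
  qed
  \<comment> \<open>Closure under \<tau> keeps the inner value in \<open>?E\<close>, where the outer
    restricted map is not the default value \<open>undefined\<close>.\<close>
  have "?\<phi> (\<sigma> \<circ> \<tau>) = compose ?E (?\<phi> \<sigma>) (?\<phi> \<tau>)" if "\<sigma> \<in> G" "\<tau> \<in> G" for \<sigma> \<tau>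
    using closed[OF that(2)] by (intro ext) (simp add: compose_def perm_ideals_comp)
  with Bij have "?\<phi> \<in> hom (sym_group n\<lparr>carrier := G\<rparr>) (BijGroup ?E)"
    by (auto intro!: homI simp: BijGroup_def sym_group_mult)
  then show ?thesis
    by (intro group_action.intro group_hom.intro group_hom_axioms.intro group_BijGroup
        subgroup.subgroup_is_group[OF assms(1)] sym_group_is_group)
qed

end
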